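(* Let $(G,\star)$ be an abelian group, let $n$ be a positive integer, and let $[\mathcal{G}g]_{G_n}^{\Box}$ be the set of generic magic squares of order $n$ derived from $(G,\star)$. Then the ordered pair $([\mathcal{G}g]_{G_n}^{\Box}, \star_p)$, where $\star_p$ denotes the group operation $\star$ applied component-wise in $\mathbb{M}_n(G)$, is an abelian group.
   Context: $\mathbb{M}_n(G)$ denotes the set of $n\times n$ matrices with entries in $G$. A generic magic square of order $n$ derived from an abelian group $(G,\star)$ is an $n\times n$ matrix with entries in $G$ such that, for every row and every column, combining all the entries of that row (respectively column) with the operation $\star$ gives one and the same element of $G$ (the generic magic constant). Entries need not be distinct, and no condition is imposed on the diagonals. The component-wise operation is $(a_{ij}) \star_p (b_{ij}) = (a_{ij} \star b_{ij})$. *)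

theory Defs
  imports "HOL-Algebra.FiniteProduct" "Jordan_Normal_Form.Matrix"
begin

text \<open>Matrices are \<open>'a mat\<close>, with rows and columns indexed by \<open>{..<n}\<close>; the entries are
  required to lie in the carrier of the group.\<close>

definition group_mats :: "('a, 'b) monoid_scheme \<Rightarrow> nat \<Rightarrow> 'a mat set" where
  "group_mats G n = {A \<in> carrier_mat n n. \<forall>i<n. \<forall>j<n. A $$ (i, j) \<in> carrier G}"

definition generic_magic_squares :: "('a, 'b) monoid_scheme \<Rightarrow> nat \<Rightarrow> 'a mat set" where
  "generic_magic_squares G n =
    {A \<in> group_mats G n. \<exists>c \<in> carrier G.
       (\<forall>i<n. (\<Otimes>\<^bsub>G\<^esub>j\<in>{..<n}. A $$ (i, j)) = c) \<and>
       (\<forall>j<n. (\<Otimes>\<^bsub>G\<^esub>i\<in>{..<n}. A $$ (i, j)) = c)}"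

definition mult_mat_pointwise :: "('a, 'b) monoid_scheme \<Rightarrow> 'a mat \<Rightarrow> 'a mat \<Rightarrow> 'a mat" where
  "mult_mat_pointwise G A B =
    mat (dim_row A) (dim_col A) (\<lambda>(i, j). A $$ (i, j) \<otimes>\<^bsub>G\<^esub> B $$ (i, j))"

text \<open>A set with a binary operation, given as an ordered pair, is an abelian group.  The group
  records of HOL-Algebra carry the neutral element as a field; it is not part of the pair, so its
  existence is asserted.\<close>

definition is_abelian_group :: "'a set \<times> ('a \<Rightarrow> 'a \<Rightarrow> 'a) \<Rightarrow> bool" where
  "is_abelian_group P \<longleftrightarrow> (\<exists>e. comm_group \<lparr>carrier = fst P, mult = snd P, one = e\<rparr>)"

end

theory Submission
  imports Defs
begin

text \<open>Finite products in an abelian group commute with products and inverses taken termwise.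
  So if two squares have magic constants \<open>c\<close> and \<open>d\<close>, their entrywise
  product has constant \<open>c \<otimes> d\<close> (\<open>mult_generic_magic_squares\<close>), the
  entrywise inverse has constant \<open>inv c\<close> (\<open>inv_generic_magic_squares\<close>),
  and the matrix of units has constant \<open>\<one>\<close>. The group laws themselves hold entry
  by entry, since they hold in \<open>G\<close>.\<close>

text \<open>Multiplied together, the two products collapse termwise to \<open>\<one>\<close>, and
  inverses are unique. For infinite \<open>A\<close> both sides are \<open>\<one>\<close>, the
  default value of \<open>finprod\<close>.\<close>

lemma (in comm_group) finprod_inv:
  assumes "f \<in> A \<rightarrow> carrier G"
  shows "(\<Otimes>x\<in>A. inv (f x)) = inv (\<Otimes>x\<in>A. f x)"
proof -
  have "(\<Otimes>x\<in>A. inv (f x)) \<otimes> (\<Otimes>x\<in>A. f x) = (\<Otimes>x\<in>A. inv (f x) \<otimes> f x)"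
    using assms by (intro finprod_multf [symmetric]) auto
  also have "\<dots> = \<one>"
    using assms by (intro finprod_one_eqI) (auto simp: Pi_iff)
  finally show ?thesis
    using assms by (intro inv_equality [symmetric]) (auto simp: Pi_iff)
qed

lemma generic_magic_squaresI:
  assumes "A \<in> carrier_mat n n" "c \<in> carrier G"
    and "\<And>i j. i < n \<Longrightarrow> j < n \<Longrightarrow> A $$ (i, j) \<in> carrier G"
    and "\<And>i. i < n \<Longrightarrow> (\<Otimes>\<^bsub>G\<^esub>j\<in>{..<n}. A $$ (i, j)) = c"
    and "\<And>j. j < n \<Longrightarrow> (\<Otimes>\<^bsub>G\<^esub>i\<in>{..<n}. A $$ (i, j)) = c"
  shows "A \<in> generic_magic_squares G n"
  using assms by (auto simp: generic_magic_squares_def group_mats_def)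

context comm_group
begin

text \<open>Moves the magic condition from matrix entries to the entry function \<open>f\<close>, so
  that later closure proofs can apply laws of \<open>finprod\<close> without unfolding matrix
  indexing.\<close>

lemma mat_mem_generic_magic_squaresI:
  assumes "c \<in> carrier G"
    and closed: "\<And>i j. i < n \<Longrightarrow> j < n \<Longrightarrow> f i j \<in> carrier G"
    and rows: "\<And>i. i < n \<Longrightarrow> (\<Otimes>j\<in>{..<n}. f i j) = c"
    and cols: "\<And>j. j < n \<Longrightarrow> (\<Otimes>i\<in>{..<n}. f i j) = c"
  shows "mat n n (\<lambda>(i, j). f i j) \<in> generic_magic_squares G n"
proof (rule generic_magic_squaresI)
  fix i assume "i < n"
  then have "(\<Otimes>j\<in>{..<n}. mat n n (\<lambda>(i, j). f i j) $$ (i, j)) = (\<Otimes>j\<in>{..<n}. f i j)"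
    \<comment> \<open>An entry of \<open>mat n n\<close> is known to equal \<open>f i j\<close> only
      for indices below \<open>n\<close>, hence a congruence over the index set; it also needs the
      values to lie in the carrier.\<close>
    using closed by (intro finprod_cong') auto
  then show "(\<Otimes>j\<in>{..<n}. mat n n (\<lambda>(i, j). f i j) $$ (i, j)) = c"
    using rows \<open>i < n\<close> by simp
next
  fix j assume "j < n"
  then have "(\<Otimes>i\<in>{..<n}. mat n n (\<lambda>(i, j). f i j) $$ (i, j)) = (\<Otimes>i\<in>{..<n}. f i j)"
    using closed by (intro finprod_cong') auto
  then show "(\<Otimes>i\<in>{..<n}. mat n n (\<lambda>(i, j). f i j) $$ (i, j)) = c"
    using cols \<open>j < n\<close> by simp
qed (use assms in auto)

lemma one_generic_magic_squares: "mat n n (\<lambda>_. \<one>) \<in> generic_magic_squares G n"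
  using mat_mem_generic_magic_squaresI [of \<one> n "\<lambda>_ _. \<one>"] by (simp add: case_prod_unfold)

lemma inv_generic_magic_squares:
  assumes "A \<in> generic_magic_squares G n"
  shows "mat n n (\<lambda>(i, j). inv (A $$ (i, j))) \<in> generic_magic_squares G n"
proof -
  from assms obtain c where A: "c \<in> carrier G"
    "\<And>i j. i < n \<Longrightarrow> j < n \<Longrightarrow> A $$ (i, j) \<in> carrier G"
    "\<And>i. i < n \<Longrightarrow> (\<Otimes>j\<in>{..<n}. A $$ (i, j)) = c"
    "\<And>j. j < n \<Longrightarrow> (\<Otimes>i\<in>{..<n}. A $$ (i, j)) = c"
    by (auto simp: generic_magic_squares_def group_mats_def)
  show ?thesis
    using A by (intro mat_mem_generic_magic_squaresI [of "inv c"]) (simp_all add: finprod_inv Pi_iff)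
qed

lemma mult_generic_magic_squares:
  assumes "A \<in> generic_magic_squares G n" "B \<in> generic_magic_squares G n"
  shows "mult_mat_pointwise G A B \<in> generic_magic_squares G n"
proof -
  from assms(1) obtain c where A: "A \<in> carrier_mat n n" "c \<in> carrier G"
    "\<And>i j. i < n \<Longrightarrow> j < n \<Longrightarrow> A $$ (i, j) \<in> carrier G"
    "\<And>i. i < n \<Longrightarrow> (\<Otimes>j\<in>{..<n}. A $$ (i, j)) = c"
    "\<And>j. j < n \<Longrightarrow> (\<Otimes>i\<in>{..<n}. A $$ (i, j)) = c"
    by (auto simp: generic_magic_squares_def group_mats_def)
  from assms(2) obtain d where B: "d \<in> carrier G"
    "\<And>i j. i < n \<Longrightarrow> j < n \<Longrightarrow> B $$ (i, j) \<in> carrier G"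
    "\<And>i. i < n \<Longrightarrow> (\<Otimes>j\<in>{..<n}. B $$ (i, j)) = d"
    "\<And>j. j < n \<Longrightarrow> (\<Otimes>i\<in>{..<n}. B $$ (i, j)) = d"
    by (auto simp: generic_magic_squares_def group_mats_def)
  have "mat n n (\<lambda>(i, j). A $$ (i, j) \<otimes> B $$ (i, j)) \<in> generic_magic_squares G n"
    using A B
    by (intro mat_mem_generic_magic_squaresI [of "c \<otimes> d"]) (simp_all add: finprod_multf Pi_iff)
  then show ?thesis
    \<comment> \<open>The product takes its dimensions from its first factor, so the shape of
      \<open>A\<close> alone identifies it with the matrix above.\<close>
    using A(1) by (simp add: mult_mat_pointwise_def)
qed

text \<open>Names the neutral element explicitly, which gives the witness for the existential in
  \<open>is_abelian_group\<close>.\<close>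

lemma comm_group_generic_magic_squares:
  "comm_group \<lparr>carrier = generic_magic_squares G n, mult = mult_mat_pointwise G,
     one = mat n n (\<lambda>_. \<one>)\<rparr>"
proof -
  have closed: "A $$ (i, j) \<in> carrier G"
    if "A \<in> generic_magic_squares G n" "i < n" "j < n" for A i j
    using that by (auto simp: generic_magic_squares_def group_mats_def)
  have dims: "dim_row A = n" "dim_col A = n" if "A \<in> generic_magic_squares G n" for A
    using that by (auto simp: generic_magic_squares_def group_mats_def)
  \<comment> \<open>A left inverse is what \<open>comm_groupI\<close> asks for; the witness is the
    matrix of entrywise inverses.\<close>
  have "\<exists>B\<in>generic_magic_squares G n. mult_mat_pointwise G B A = mat n n (\<lambda>_. \<one>)"
    if "A \<in> generic_magic_squares G n" for A
    using that
    by (intro bexI [OF _ inv_generic_magic_squares [OF that]] eq_matI)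
      (simp_all add: mult_mat_pointwise_def closed)
  then show ?thesis
  proof (intro comm_groupI, simp_all add: mult_generic_magic_squares one_generic_magic_squares)
    fix A B assume "A \<in> generic_magic_squares G n" "B \<in> generic_magic_squares G n"
    then show "mult_mat_pointwise G A B = mult_mat_pointwise G B A"
      by (intro eq_matI) (simp_all add: mult_mat_pointwise_def dims closed m_comm)
  qed (auto simp: mult_mat_pointwise_def dims closed m_assoc intro!: eq_matI)
qed

end

theorem theorem3p6:
  fixes G :: "('a, 'b) monoid_scheme" and n :: nat
  assumes "comm_group G" and "n \<ge> 1"
  shows "is_abelian_group (generic_magic_squares G n, mult_mat_pointwise G)"
  using comm_group.comm_group_generic_magic_squares [OF assms(1), of n]
  by (auto simp: is_abelian_group_def)

end
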